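(* For every real $p>0$, the set $\ell_{p}-\bigcup_{0<q<p}\ell_{q}$ is spaceable in $\ell_p$.
   Context: The scalar field $\mathbb{K}$ is either $\mathbb{R}$ or $\mathbb{C}$. For $0<p<\infty$, $\ell_p$ is the space of scalar sequences $(x_j)_{j=1}^\infty$ with $\sum_j|x_j|^p<\infty$, with its usual norm if $p\geq 1$ and its usual ($p$-norm) quasi-norm $\|x\|_p=(\sum_j|x_j|^p)^{1/p}$ if $0<p<1$. A subset $A$ of a Banach or quasi-Banach space $E$ is spaceable (in $E$) if $A\cup\{0\}$ contains a closed infinite-dimensional linear subspace of $E$. The minus sign denotes set difference. *)

theory Defs
  imports "HOL-Analysis.Analysis" "HOL-Library.Function_Algebras"
begin

definition seq_scale :: "'a::real_normed_field \<Rightarrow> (nat \<Rightarrow> 'a) \<Rightarrow> nat \<Rightarrow> 'a"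
  where "seq_scale c x = (\<lambda>j. c * x j)"

text \<open>The scalars are the field \<open>'a\<close> itself, so for \<open>'a = complex\<close> subspaces, spans and
  dimensions are complex-linear; addition of sequences is that of \<^theory>\<open>HOL-Library.Function_Algebras\<close>.\<close>

global_interpretation seq_space: vector_space "seq_scale :: 'a::real_normed_field \<Rightarrow> _"
  by unfold_locales (auto simp: seq_scale_def fun_eq_iff algebra_simps)

text \<open>Sequences are indexed from \<open>0\<close>. Note that \<open>0 powr p = 0\<close>, so zero terms contribute nothing.\<close>

definition lp :: "real \<Rightarrow> (nat \<Rightarrow> 'a::real_normed_field) set"
  where "lp p = {x. summable (\<lambda>j. norm (x j) powr p)}"

definition lp_norm :: "real \<Rightarrow> (nat \<Rightarrow> 'a::real_normed_field) \<Rightarrow> real"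
  where "lp_norm p x = (\<Sum>j. norm (x j) powr p) powr (1 / p)"

definition quasinorm_topology :: "'v::ab_group_add set \<Rightarrow> ('v \<Rightarrow> real) \<Rightarrow> 'v topology"
  where "quasinorm_topology E N =
    topology (\<lambda>U. U \<subseteq> E \<and> (\<forall>x\<in>U. \<exists>r>0. \<forall>y\<in>E. N (y - x) < r \<longrightarrow> y \<in> U))"

lemma openin_quasinorm_topology:
  "openin (quasinorm_topology E N) U \<longleftrightarrow>
    U \<subseteq> E \<and> (\<forall>x\<in>U. \<exists>r>0. \<forall>y\<in>E. N (y - x) < r \<longrightarrow> y \<in> U)"
proof -
  let ?P = "\<lambda>U. U \<subseteq> E \<and> (\<forall>x\<in>U. \<exists>r>0. \<forall>y\<in>E. N (y - x) < r \<longrightarrow> y \<in> U)"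
  have "?P (S \<inter> T)" if S: "?P S" and T: "?P T" for S T
  proof (intro conjI ballI)
    show "S \<inter> T \<subseteq> E" using S by blast
    fix x assume "x \<in> S \<inter> T"
    then obtain r s where "r > 0" "\<forall>y\<in>E. N (y - x) < r \<longrightarrow> y \<in> S"
      and "s > 0" "\<forall>y\<in>E. N (y - x) < s \<longrightarrow> y \<in> T" using S T by blast
    then show "\<exists>r>0. \<forall>y\<in>E. N (y - x) < r \<longrightarrow> y \<in> S \<inter> T"
      by (intro exI[of _ "min r s"]) auto
  qed
  moreover have "?P (\<Union>\<K>)" if "\<forall>K\<in>\<K>. ?P K" for \<K>
    using that by (meson Union_iff Union_least)
  ultimately have "istopology ?P" unfolding istopology_def by blast
  then show ?thesis by (simp add: quasinorm_topology_def topology_inverse')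
qed

lemma topspace_quasinorm_topology [simp]: "topspace (quasinorm_topology E N) = E"
  unfolding topspace_def openin_quasinorm_topology by (auto intro: zero_less_one)

abbreviation lp_topology :: "real \<Rightarrow> (nat \<Rightarrow> 'a::real_normed_field) topology"
  where "lp_topology p \<equiv> quasinorm_topology (lp p) (lp_norm p)"

definition infinite_dimensional :: "(nat \<Rightarrow> 'a::real_normed_field) set \<Rightarrow> bool"
  where "infinite_dimensional V \<longleftrightarrow> \<not> (\<exists>B. finite B \<and> seq_space.span B = V)"

text \<open>The ambient space \<open>E\<close> is given by its topology; \<open>closedin\<close> forces \<open>V\<close> to lie in it.\<close>

definition spaceable :: "(nat \<Rightarrow> 'a::real_normed_field) topology \<Rightarrow> (nat \<Rightarrow> 'a) set \<Rightarrow> bool"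
  where "spaceable T A \<longleftrightarrow>
    (\<exists>V. seq_space.subspace V \<and> infinite_dimensional V \<and> closedin T V \<and> V \<subseteq> A \<union> {0})"

end

theory Submission
  imports Defs "HOL-Real_Asymp.Real_Asymp"
begin

text \<open>
  Start from one sequence \<open>u\<close> in \<open>lp p\<close> that lies in no \<open>lp q\<close> with \<open>0 < q < p\<close>; the choice
  \<open>u n = (1 / (n * (ln (n + 1))^2)) powr (1 / p)\<close> works, since \<open>\<Sum> 1 / (n * (ln (n + 1))^2)\<close> converges while
  any power of its terms with exponent below \<open>1\<close> eventually dominates \<open>1 / n\<close>.
  Identify the index set with \<open>nat \<times> nat\<close> and read a sequence as an infinite matrix.  The space
  \<open>proportional_rows p u\<close> of all matrices in \<open>lp p\<close> whose rows are all scalar multiples of \<open>u\<close> has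
  the required properties:

  \<^item> A nonzero member has a row that is a nonzero multiple of \<open>u\<close>.  If it were in \<open>lp q\<close>, so would
    be that row, hence \<open>u\<close>.

  \<^item> It is infinite-dimensional, because \<open>u\<close> may be placed in any single row.

  \<^item> It is closed.  This is the point of fixing \<open>u\<close>: proportionality of the rows to \<open>u\<close> is
    expressed by linear equations that each involve only two coordinates.  Every coordinate is
    bounded by the quasi-norm, whether \<open>p < 1\<close> or \<open>p \<ge> 1\<close>, so such an equation that fails at a
    point of \<open>lp p\<close> also fails near it.
\<close>

section \<open>The sequence spaces\<close>

text \<open>Unordered summability is indifferent to reindexing, unlike \<open>summable\<close>.\<close>

lemma lp_iff_summable_on: "x \<in> lp p \<longleftrightarrow> (\<lambda>j. norm (x j) powr p) summable_on UNIV"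
  unfolding lp_def by (simp add: summable_on_UNIV_nonneg_real_iff)

lemma lp_subsequence:
  assumes "inj g" "x \<in> lp p"
  shows "(\<lambda>n. x (g n)) \<in> lp p"
proof -
  have "(\<lambda>j. norm (x j) powr p) summable_on range g"
    using assms(2) unfolding lp_iff_summable_on
    by (rule summable_on_subset_banach) simp
  then show ?thesis
    unfolding lp_iff_summable_on summable_on_reindex[OF assms(1)] by (simp add: o_def)
qed

lemma lp_if_subsequence_covers_support:
  assumes "inj g" "\<And>j. j \<notin> range g \<Longrightarrow> x j = 0" "(\<lambda>n. x (g n)) \<in> lp p"
  shows "x \<in> lp p"
proof -
  have "(\<lambda>j. norm (x j) powr p) summable_on range g"
    using assms(3) unfolding lp_iff_summable_on summable_on_reindex[OF assms(1)]
    by (simp add: o_def)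
  also have "?this \<longleftrightarrow> (\<lambda>j. norm (x j) powr p) summable_on UNIV"
    by (rule summable_on_cong_neutral) (use assms(2) in auto)
  finally show ?thesis
    unfolding lp_iff_summable_on .
qed

lemma lp_scale:
  assumes "x \<in> lp p"
  shows "(\<lambda>j. c * x j) \<in> lp p"
proof -
  have "norm (c * x j) powr p = norm c powr p * norm (x j) powr p" for j
    by (simp add: norm_mult powr_mult)
  with assms show ?thesis
    by (simp add: lp_def summable_mult)
qed

text \<open>
  For \<open>s, t \<ge> 0\<close> one has \<open>(s + t) powr p \<le> (2 * max s t) powr p\<close>, which
  bounds the sum by the two given series for every positive exponent.
\<close>

lemma lp_add:
  assumes "p > 0" "x \<in> lp p" "y \<in> lp p"
  shows "x + y \<in> lp p"
proof -
  let ?b = "\<lambda>j. 2 powr p * (norm (x j) powr p + norm (y j) powr p)"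
  have bound: "norm ((x + y) j) powr p \<le> ?b j" for j
  proof -
    let ?m = "max (norm (x j)) (norm (y j))"
    have "norm (x j + y j) \<le> 2 * ?m"
      using norm_triangle_ineq[of "x j" "y j"] by linarith
    then have "norm (x j + y j) powr p \<le> (2 * ?m) powr p"
      by (rule powr_mono2[rotated 2]) (use assms(1) in auto)
    also have "\<dots> = 2 powr p * ?m powr p"
      by (rule powr_mult)
    also have "?m powr p \<le> norm (x j) powr p + norm (y j) powr p"
      by (auto simp: max_def)
    finally show ?thesis
      by simp
  qed
  have "summable ?b"
    using assms(2,3) by (auto simp: lp_def intro!: summable_mult summable_add)
  then show ?thesis
    unfolding lp_def mem_Collect_eq
    by (rule summable_comparison_test'[where N = 0]) (use bound in simp)
qed

lemma subspace_lp:
  assumes "p > 0"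
  shows "seq_space.subspace (lp p)"
  by (rule seq_space.subspaceI)
     (use assms in \<open>auto simp: seq_scale_def lp_add lp_scale, auto simp: lp_def\<close>)

lemma norm_le_lp_norm:
  assumes "p > 0" "x \<in> lp p"
  shows "norm (x j) \<le> lp_norm p x"
proof -
  have "norm (x j) powr p \<le> (\<Sum>i. norm (x i) powr p)"
    using sum_le_suminf[of "\<lambda>i. norm (x i) powr p" "{j}"] assms(2) by (simp add: lp_def)
  then have "(norm (x j) powr p) powr (1 / p) \<le> lp_norm p x"
    unfolding lp_norm_def by (rule powr_mono2[rotated 2]) (use assms(1) in auto)
  then show ?thesis
    using assms(1) by (simp add: powr_powr)
qed

lemma infinite_dimensional_if_biorthogonal:
  fixes e :: "nat \<Rightarrow> nat \<Rightarrow> 'a::real_normed_field"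
  assumes "\<And>m. e m \<in> V" "\<And>m. e m (i m) \<noteq> 0" "\<And>m l. l \<noteq> m \<Longrightarrow> e l (i m) = 0"
  shows "infinite_dimensional V"
proof -
  have indep: "seq_space.independent (range e)"
    unfolding seq_space.independent_explicit_module
  proof (intro allI impI)
    fix t c v
    assume t: "finite t" "t \<subseteq> range e" "v \<in> t" and "(\<Sum>w\<in>t. seq_scale (c w) w) = 0"
    obtain m where m: "v = e m"
      using t by blast
    have "(\<Sum>w\<in>t. seq_scale (c w) w) (i m) = (\<Sum>w\<in>t. c w * w (i m))"
      using t(1) by induction (auto simp: seq_scale_def)
    also have "\<dots> = (\<Sum>w\<in>t. if w = v then c v * v (i m) else 0)"
    proof (rule sum.cong)
      fix w
      assume "w \<in> t"
      then obtain l where "w = e l"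
        using t(2) by blast
      then show "c w * w (i m) = (if w = v then c v * v (i m) else 0)"
        using assms(3)[of l m] m by (cases "l = m") auto
    qed simp
    also have "\<dots> = c v * v (i m)"
      using t by simp
    finally show "c v = 0"
      using \<open>(\<Sum>w\<in>t. seq_scale (c w) w) = 0\<close> assms(2)[of m] m by simp
  qed
  have "inj e"
    using assms(2,3) by (intro injI) metis
  then have "infinite (range e)"
    by (rule range_inj_infinite)
  moreover have "range e \<subseteq> V"
    using assms(1) by blast
  ultimately show ?thesis
    unfolding infinite_dimensional_def using seq_space.independent_span_bound[OF _ indep] by blast
qed

section \<open>Matrices with rows proportional to a fixed sequence\<close>

text \<open>
  The equations say that each row of \<open>x\<close>, paired with \<open>u\<close>, has vanishing two-by-two minors; for
  \<open>u \<noteq> 0\<close> this means that the row is a multiple of \<open>u\<close>.  Stating it without naming the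
  multiples makes it a family of continuous linear conditions on \<open>x\<close>.
\<close>

definition proportional_rows ::
    "real \<Rightarrow> (nat \<Rightarrow> 'a::real_normed_field) \<Rightarrow> (nat \<Rightarrow> 'a) set"
  where "proportional_rows p u =
    {x \<in> lp p. \<forall>m n k. x (prod_encode (m, n)) * u k = x (prod_encode (m, k)) * u n}"

lemma subspace_proportional_rows:
  assumes "p > 0"
  shows "seq_space.subspace (proportional_rows p u)"
proof (rule seq_space.subspaceI)
  note lp = subspace_lp[OF assms]
  show "0 \<in> proportional_rows p u"
    using seq_space.subspace_0[OF lp] by (simp add: proportional_rows_def)
  show "x + y \<in> proportional_rows p u"
    if "x \<in> proportional_rows p u" "y \<in> proportional_rows p u" for x y
    using that seq_space.subspace_add[OF lp, of x y]
    by (simp add: proportional_rows_def distrib_right)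
  show "seq_scale c x \<in> proportional_rows p u" if "x \<in> proportional_rows p u" for c x
    using that seq_space.subspace_scale[OF lp, of x c]
    by (simp add: proportional_rows_def seq_scale_def mult.assoc)
qed

lemma closedin_proportional_rows:
  fixes u :: "nat \<Rightarrow> 'a::real_normed_field"
  assumes "p > 0"
  shows "closedin (lp_topology p) (proportional_rows p u)"
  unfolding closedin_def topspace_quasinorm_topology openin_quasinorm_topology
proof (intro conjI ballI)
  show "proportional_rows p u \<subseteq> lp p"
    by (auto simp: proportional_rows_def)
  show "lp p - proportional_rows p u \<subseteq> lp p"
    by blast
  fix x
  assume "x \<in> lp p - proportional_rows p u"
  then obtain m n k where x: "x \<in> lp p"
    and neq: "x (prod_encode (m, n)) * u k \<noteq> x (prod_encode (m, k)) * u n"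
    by (auto simp: proportional_rows_def)
  let ?minor = "\<lambda>z :: nat \<Rightarrow> 'a. z (prod_encode (m, n)) * u k - z (prod_encode (m, k)) * u n"
  define K where "K = norm (u k) + norm (u n)"
  have "K > 0"
  proof -
    have "u k \<noteq> 0 \<or> u n \<noteq> 0"
      using neq by auto
    then show ?thesis
      by (auto simp: K_def add_pos_nonneg add_nonneg_pos)
  qed
  have minor_bound: "norm (?minor z) \<le> lp_norm p z * K" if "z \<in> lp p" for z
  proof -
    have "norm (?minor z) \<le> norm (z (prod_encode (m, n))) * norm (u k)
        + norm (z (prod_encode (m, k))) * norm (u n)"
      by (metis norm_triangle_ineq4 norm_mult)
    also have "\<dots> \<le> lp_norm p z * norm (u k) + lp_norm p z * norm (u n)"
      by (intro add_mono mult_right_mono norm_le_lp_norm assms that norm_ge_zero)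
    finally show ?thesis
      by (simp add: K_def distrib_left)
  qed
  \<comment> \<open>A perturbation below this radius changes the minor by less than its norm at \<open>x\<close>.\<close>
  show "\<exists>r>0. \<forall>y\<in>lp p. lp_norm p (y - x) < r \<longrightarrow> y \<in> lp p - proportional_rows p u"
  proof (intro exI[of _ "norm (?minor x) / K"] conjI ballI impI)
    show "norm (?minor x) / K > 0"
      using neq \<open>K > 0\<close> by simp
    fix y
    assume y: "y \<in> lp p" and "lp_norm p (y - x) < norm (?minor x) / K"
    have "y - x \<in> lp p"
      using seq_space.subspace_diff[OF subspace_lp] assms x y by blast
    then have "norm (?minor (y - x)) < norm (?minor x)"
      using minor_bound[of "y - x"] \<open>lp_norm p (y - x) < _\<close> \<open>K > 0\<close>
      by (simp add: pos_less_divide_eq)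
    moreover have "?minor (y - x) = - (?minor x - ?minor y)"
      by (simp add: algebra_simps)
    ultimately have "norm (?minor x - ?minor y) < norm (?minor x)"
      by (simp only: norm_minus_cancel)
    then have "?minor y \<noteq> 0"
      by (auto simp only: diff_zero less_irrefl)
    with y show "y \<in> lp p - proportional_rows p u"
      by (auto simp: proportional_rows_def)
  qed
qed

lemma infinite_dimensional_proportional_rows:
  fixes u :: "nat \<Rightarrow> 'a::real_normed_field"
  assumes "u \<in> lp p" "u \<noteq> 0"
  shows "infinite_dimensional (proportional_rows p u)"
proof -
  obtain k where k: "u k \<noteq> 0"
    using assms(2) by (auto simp: fun_eq_iff)
  define e where "e m j = (case prod_decode j of (l, n) \<Rightarrow> if l = m then u n else 0)" for m j
  have e: "e m (prod_encode (l, n)) = (if l = m then u n else 0)" for m l n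
    by (simp add: e_def)
  have "e m \<in> lp p" for m
  proof (rule lp_if_subsequence_covers_support)
    show "inj (\<lambda>n. prod_encode (m, n))"
      by (simp add: inj_def)
    show "e m j = 0" if "j \<notin> range (\<lambda>n. prod_encode (m, n))" for j
    proof (rule ccontr)
      obtain l n where j: "j = prod_encode (l, n)"
        by (metis prod_decode_inverse surj_pair)
      assume "e m j \<noteq> 0"
      then have "l = m"
        unfolding j e by (auto split: if_splits)
      then show False
        using that j by blast
    qed
    show "(\<lambda>n. e m (prod_encode (m, n))) \<in> lp p"
      using assms(1) by (simp add: e)
  qed
  then have "e m \<in> proportional_rows p u" for m
    by (simp add: proportional_rows_def e)
  then show ?thesis
    by (rule infinite_dimensional_if_biorthogonal[where i = "\<lambda>m. prod_encode (m, k)"])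
       (use k in \<open>auto simp: e\<close>)
qed

lemma mem_lp_if_proportional_rows_mem_lp:
  assumes "x \<in> proportional_rows p u" "x \<noteq> 0" "x \<in> lp q"
  shows "u \<in> lp q"
proof -
  obtain m k where mk: "x (prod_encode (m, k)) \<noteq> 0"
  proof -
    obtain j where "x j \<noteq> 0"
      using assms(2) by (auto simp: fun_eq_iff)
    then show ?thesis
      using that[of "fst (prod_decode j)" "snd (prod_decode j)"] by simp
  qed
  let ?c = "u k / x (prod_encode (m, k))"
  have "(\<lambda>n. x (prod_encode (m, n))) \<in> lp q"
    by (rule lp_subsequence[OF _ assms(3)]) (simp add: inj_def)
  then have "(\<lambda>n. ?c * x (prod_encode (m, n))) \<in> lp q"
    by (rule lp_scale)
  moreover have "(\<lambda>n. ?c * x (prod_encode (m, n))) = u"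
  proof
    fix n
    have "x (prod_encode (m, n)) * u k = x (prod_encode (m, k)) * u n"
      using assms(1) by (simp add: proportional_rows_def)
    then show "?c * x (prod_encode (m, n)) = u n"
      using mk by (simp add: field_simps)
  qed
  ultimately show ?thesis
    by simp
qed

proposition spaceable_lp_minus_if_witness:
  fixes u :: "nat \<Rightarrow> 'a::real_normed_field"
  assumes "p > 0" "u \<in> lp p" "u \<noteq> 0" "\<And>q. q \<in> Q \<Longrightarrow> u \<notin> lp q"
  shows "spaceable (lp_topology p) ((lp p :: (nat \<Rightarrow> 'a) set) - (\<Union>q\<in>Q. lp q))"
  unfolding spaceable_def
proof (intro exI conjI)
  show "seq_space.subspace (proportional_rows p u)"
    using assms(1) by (rule subspace_proportional_rows)
  show "infinite_dimensional (proportional_rows p u)"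
    using assms(2,3) by (rule infinite_dimensional_proportional_rows)
  show "closedin (lp_topology p) (proportional_rows p u)"
    using assms(1) by (rule closedin_proportional_rows)
  have "proportional_rows p u \<subseteq> lp p"
    by (auto simp: proportional_rows_def)
  then show "proportional_rows p u \<subseteq> lp p - (\<Union>q\<in>Q. lp q) \<union> {0}"
    using mem_lp_if_proportional_rows_mem_lp[of _ p u] assms(4) by blast
qed

section \<open>A sequence with sharp summability exponent\<close>

text \<open>
  By Cauchy condensation the series behaves like \<open>\<Sum> 1 / k\<^sup>2\<close>.  The shift of the argument
  keeps the logarithm away from \<open>0\<close>, which makes the terms decreasing from the start.
\<close>

lemma summable_inverse_mult_ln_squared:
  "summable (\<lambda>n. 1 / (real n * (ln (real n + 1))\<^sup>2))"
proof -
  let ?f = "\<lambda>n. 1 / (real n * (ln (real n + 1))\<^sup>2)"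
  have "summable ?f \<longleftrightarrow> summable (\<lambda>k. 2 ^ k * ?f (2 ^ k))"
  proof (rule condensation_test)
    fix m :: nat
    assume "0 < m"
    then show "?f (Suc m) \<le> ?f m"
      by (intro divide_left_mono mult_mono power_mono mult_pos_pos) auto
  qed simp
  also have "\<dots>"
  proof (rule summable_comparison_test_bigo)
    show "summable (\<lambda>k. norm (1 / real k ^ 2))"
      using inverse_power_summable[of 2, where ?'a = real] by (simp add: field_simps)
    show "(\<lambda>k. 2 ^ k * ?f (2 ^ k)) \<in> O(\<lambda>k. 1 / real k ^ 2)"
      unfolding of_nat_power of_nat_numeral by real_asymp
  qed
  finally show ?thesis .
qed

lemma not_summable_inverse_mult_ln_squared_powr:
  assumes "s < 1"
  shows "\<not> summable (\<lambda>n. (1 / (real n * (ln (real n + 1))\<^sup>2)) powr s)"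
proof
  assume "summable (\<lambda>n. (1 / (real n * (ln (real n + 1))\<^sup>2)) powr s)"
  then have "summable (\<lambda>n. norm ((1 / (real n * (ln (real n + 1))\<^sup>2)) powr s))"
    by simp
  moreover have "(\<lambda>n. inverse (real n)) \<in> O(\<lambda>n. (1 / (real n * (ln (real n + 1))\<^sup>2)) powr s)"
    using assms by real_asymp
  ultimately have "summable (\<lambda>n. inverse (real n))"
    by (rule summable_comparison_test_bigo)
  then show False
    using not_summable_harmonic[where ?'a = real] by simp
qed

lemma ex_mem_lp_not_mem_smaller_lp:
  assumes "p > 0"
  shows "\<exists>u :: nat \<Rightarrow> 'a::real_normed_field. u \<in> lp p \<and> (\<forall>q\<in>{0<..<p}. u \<notin> lp q)"
proof -
  let ?w = "\<lambda>n. 1 / (real n * (ln (real n + 1))\<^sup>2)"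
  define u :: "nat \<Rightarrow> 'a" where "u n = of_real (?w n powr (1 / p))" for n
  have "norm (u n) powr q = ?w n powr (q / p)" for n q
    by (simp add: u_def powr_powr)
  then have lp_iff: "u \<in> lp q \<longleftrightarrow> summable (\<lambda>n. ?w n powr (q / p))" for q
    by (simp add: lp_def)
  have "u \<in> lp p"
    unfolding lp_iff using assms summable_inverse_mult_ln_squared by simp
  moreover have "u \<notin> lp q" if "q \<in> {0<..<p}" for q
    unfolding lp_iff using that by (intro not_summable_inverse_mult_ln_squared_powr) simp
  ultimately show ?thesis
    by blast
qed

section \<open>Spaceability\<close>

lemma spaceable_lp_minus_smaller_lp:
  assumes "p > 0"
  shows "spaceable (lp_topology p)
    ((lp p :: (nat \<Rightarrow> 'a::real_normed_field) set) - (\<Union>q\<in>{0<..<p}. lp q))"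
proof -
  obtain u :: "nat \<Rightarrow> 'a" where u: "u \<in> lp p" "\<And>q. q \<in> {0<..<p} \<Longrightarrow> u \<notin> lp q"
    using ex_mem_lp_not_mem_smaller_lp[OF assms] by blast
  \<comment> \<open>The zero sequence lies in every \<open>lp q\<close>, so missing one of them suffices.\<close>
  have "u \<notin> lp (p / 2)"
    using assms by (intro u(2)) simp
  then have "u \<noteq> 0"
    using seq_space.subspace_0[OF subspace_lp, of "p / 2"] assms by auto
  then show ?thesis
    using spaceable_lp_minus_if_witness[OF assms u(1)] u(2) by blast
qed

theorem corollary1p7:
  fixes p :: real
  assumes "p > 0"
  shows "spaceable (lp_topology p) ((lp p :: (nat \<Rightarrow> real) set) - (\<Union>q\<in>{0<..<p}. lp q))
       \<and> spaceable (lp_topology p) ((lp p :: (nat \<Rightarrow> complex) set) - (\<Union>q\<in>{0<..<p}. lp q))"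
  by (intro conjI spaceable_lp_minus_smaller_lp assms)

end
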